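(* Consider the problem $\min_{X=(X_0,\dots,X_M)}\Omega(X_0,\dots,X_M)$. There exists a sequence of positive (semidefinite) linear operators $\{\mathcal S_i\}_{i=0}^M$ such that, when the proximal block coordinate descent algorithm is applied (blocks updated in the order $i=M,M-1,\dots,0$), each subproblem $$\min_{X_i}\ \Omega(X_0^{k},\dots,X_{i-1}^{k},X_i,X_{i+1}^{k+1},\dots,X_M^{k+1})+\frac12\|X_i-X_i^k\|_{\mathcal S_i}^2$$ admits, for all iterations $k\ge0$ and blocks $i=0,\dots,M$, the closed-form solution $$X_i^{k+1}=\Pi_{\widetilde\Gamma_+^n}(\Delta_i^k)\ \ (i=1,\dots,M),\qquad X_0^{k+1}=\Pi_{\widetilde\Gamma_+^p}(\Delta_0^k),$$ where $\Delta_i^k=\rho_i^{-1}\big(H_i(X_{-i}^k)+\rho_iX_i^k-L_iX_i^k\big)$ and $X_{-i}^k=(X_0^k,\dots,X_{i-1}^k,X_{i+1}^{k+1},\dots,X_M^{k+1})$.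
   Context: Data. Let $m,n,l,q,M\ge1$, $p=m+n$; $A,B_2,B_1,C,D$ real matrices of sizes $n\times n$, $n\times m$, $n\times l$, $q\times n$, $q\times m$; $Q=\begin{bmatrix}B_1B_1^\top&0\\0&0\end{bmatrix}$, $R=\begin{bmatrix}C^\top C&0\\0&D^\top D\end{bmatrix}\in\mathbb S^p$ (symmetric matrices); $F_i=\begin{bmatrix}A_i&B_{2,i}\\0&0\end{bmatrix}\in\mathbb R^{p\times p}$, $i=1,\dots,M$; $V_2=[I_n,0]\in\mathbb R^{n\times p}$; $\Upsilon_i(W)=-V_2(F_iW+WF_i^\top+Q)V_2^\top$. Standing assumptions. (1) $C^\top D=0$, $D^\top D\succ0$, $C^\top C\succ0$, $B_1B_1^\top\succ0$, $(A,B_2)$ stabilizable, $(A,C)$ without unobservable modes on the imaginary axis. (2) $\begin{bmatrix}A&B_2\\0&0\end{bmatrix}$ is a convex combination of $F_1,\dots,F_M$. (3) There is $W\in\mathbb S^p$ with $W\succ0$ and $\Upsilon_i(W)\succ0$ for all $i$. (4) Every $W\in\mathbb S^p$ with $W\succeq0$ and $\Upsilon_i(W)\succeq0$ for all $i$ has positive definite upper-left $n\times n$ block. Notation. $\mathrm{vec}$ stacks columns. For $S\in\mathbb S^k$, $\mathrm{svec}(S)\in\mathbb R^{k(k+1)/2}$ lists the entries of one triangle of $S$ (each once, without scaling); $\widetilde\Gamma_+^k=\{\mathrm{svec}(S):S\in\mathbb S^k,S\succeq0\}$; $\Pi_E$ is the Euclidean projection onto $E$ and $\delta_E$ the indicator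 function; $\|x\|_{\mathcal S}^2=\langle x,\mathcal Sx\rangle$. $D_1$ is the matrix with $\mathrm{vec}(W)=D_1\mathrm{svec}(W)$ for $W\in\mathbb S^p$, and $T_2$ a matrix with $\mathrm{svec}(S)=T_2\mathrm{vec}(S)$ for $S\in\mathbb S^n$. Fix $\beta>0$ and a vector $\xi_n\in\mathbb R^{p^2}$ (in the paper $\xi_n=\widetilde W_n+\beta^{-1}u_n$ for current outer iterates $\widetilde W_n,u_n$). Put $\Xi_i=V_2\otimes V_2F_i+V_2F_i\otimes V_2$ and, for $X_0\in\mathbb R^{p(p+1)/2}$, $X_1,\dots,X_M\in\mathbb R^{n(n+1)/2}$, $$\mathcal L^\star(X_0,\dots,X_M)=D_1^\top\mathrm{vec}(R)-X_0+D_1^\top\sum_{i=1}^M\Xi_i^\top T_2^\top X_i,$$ $$\begin{aligned}\Omega(X_0,\dots,X_M)=&-\Big\langle\sum_{i=1}^MX_i,\,T_2(V_2\otimes V_2)\mathrm{vec}(Q)\Big\rangle-\langle\mathcal L^\star(X),(D_1^\top D_1)^{-1}D_1^\top\xi_n\rangle\\&+\frac1{2\beta}\|(D_1^\top D_1)^{-1/2}\mathcal L^\star(X)\|^2+\delta_{\widetilde\Gamma_+^p}(X_0)+\sum_{i=1}^M\delta_{\widetilde\Gamma_+^n}(X_i).\end{aligned}$$ Let $\mathcal L^\star(X_{-i})=\mathcal L^\star(X)-D_1^\top\Xi_i^\top T_2^\top X_i$ for $i\ge1$ and $\mathcal L^\star(X_{-0})=\mathcal L^\star(X)+X_0$ (the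 parts not depending on $X_i$, resp. $X_0$). For $i\ge1$, $$L_i=\tfrac1\beta T_2\Xi_iD_1(D_1^\top D_1)^{-1}D_1^\top\Xi_i^\top T_2^\top,$$ $$H_i(X_{-i})=T_2(V_2\otimes V_2)\mathrm{vec}(Q)+T_2\Xi_iD_1(D_1^\top D_1)^{-1}D_1^\top\xi_n-\tfrac1\beta T_2\Xi_iD_1(D_1^\top D_1)^{-1}\mathcal L^\star(X_{-i});$$ and $L_0=\tfrac1\beta(D_1^\top D_1)^{-1}$, $H_0(X_{-0})=-(D_1^\top D_1)^{-1}D_1^\top\xi_n+\tfrac1\beta(D_1^\top D_1)^{-1}\mathcal L^\star(X_{-0})$. Finally $\rho_i$ is the largest eigenvalue of $L_i$, $i=0,\dots,M$. *)

theory Defs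
  imports "HOL-Analysis.Analysis" "HOL-Library.Uprod"
begin

instance uprod :: (finite) finite
  by standard simp

section \<open>Matrices\<close>

definition psd :: "real^'k^'k \<Rightarrow> bool" where
  "psd S \<longleftrightarrow> transpose S = S \<and> (\<forall>x. 0 \<le> x \<bullet> (S *v x))"

definition pd :: "real^'k^'k \<Rightarrow> bool" where
  "pd S \<longleftrightarrow> transpose S = S \<and> (\<forall>x. x \<noteq> 0 \<longrightarrow> 0 < x \<bullet> (S *v x))"

definition psd_operator :: "('a::real_inner \<Rightarrow> 'a) \<Rightarrow> bool" where
  "psd_operator S \<longleftrightarrow> linear S \<and> (\<forall>x y. S x \<bullet> y = x \<bullet> S y) \<and> (\<forall>x. 0 \<le> x \<bullet> S x)"

definition block_mat ::
  "real^'n^'a \<Rightarrow> real^'m^'a \<Rightarrow> real^'n^'b \<Rightarrow> real^'m^'b \<Rightarrow> real^('n::finite + 'm::finite)^('a + 'b)" where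
  "block_mat A B C D = (\<chi> r c. case r of
       Inl i \<Rightarrow> (case c of Inl j \<Rightarrow> A $ i $ j | Inr j \<Rightarrow> B $ i $ j)
     | Inr i \<Rightarrow> (case c of Inl j \<Rightarrow> C $ i $ j | Inr j \<Rightarrow> D $ i $ j))"

definition upper_left :: "real^('n::finite + 'm::finite)^('n + 'm) \<Rightarrow> real^'n^'n" where
  "upper_left W = (\<chi> i j. W $ Inl i $ Inl j)"

definition eigenvalue :: "'a::field^'k^'k \<Rightarrow> 'a \<Rightarrow> bool" where
  "eigenvalue A a \<longleftrightarrow> (\<exists>v. v \<noteq> 0 \<and> A *v v = a *s v)"

definition max_eigenvalue :: "real^'k^'k \<Rightarrow> real" where
  "max_eigenvalue A = Max {a. eigenvalue A a}"

definition psd_sqrt :: "real^'k^'k \<Rightarrow> real^'k^'k" where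
  "psd_sqrt A = (THE B. psd B \<and> B ** B = A)"

definition complex_mat :: "real^'a^'b \<Rightarrow> complex^'a^'b" where
  "complex_mat A = (\<chi> i j. complex_of_real (A $ i $ j))"

definition stabilizable :: "real^'n^'n \<Rightarrow> real^'m^'n \<Rightarrow> bool" where
  "stabilizable A B \<longleftrightarrow>
     (\<exists>K :: real^'n^'m. \<forall>a. eigenvalue (complex_mat (A + B ** K)) a \<longrightarrow> Re a < 0)"

definition unobservable_mode :: "real^'n^'n \<Rightarrow> real^'n^'q \<Rightarrow> complex \<Rightarrow> bool" where
  "unobservable_mode A C a \<longleftrightarrow>
     (\<exists>v. v \<noteq> 0 \<and> complex_mat A *v v = a *s v \<and> complex_mat C *v v = 0)"

section \<open>Vectorization\<close>

text \<open>The entry of the stacked-columns vector at index (c, r) is the entry in column c and row r,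
  so that in lexicographic order the row index varies fastest. The Kronecker product uses
  the same order, hence multiplying it with the vectorization of X gives the vectorization
  of \<open>B ** X ** transpose A\<close>.\<close>

definition vec_cols :: "real^'a^'b \<Rightarrow> real^('a \<times> 'b)" where
  "vec_cols X = (\<chi> p. X $ snd p $ fst p)"

definition kron :: "real^'b^'a \<Rightarrow> real^'d^'c \<Rightarrow> real^('b \<times> 'd)^('a \<times> 'c)" where
  "kron A B = (\<chi> r c. A $ fst r $ fst c * B $ snd r $ snd c)"

text \<open>The positions of one triangle of a k by k matrix are the unordered pairs of indices
  (equal entries allowed); there are k(k+1)/2 of them. The entry selected below is well defined
  only for symmetric S, and \<open>svec\<close> is used only for those.\<close>

definition svec :: "real^'k^'k \<Rightarrow> real^('k uprod)" where
  "svec S = (\<chi> u. THE a. \<exists>i j. u = Upair i j \<and> a = S $ i $ j)"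

definition svec_cone :: "(real^('k::finite uprod)) set" where
  "svec_cone = svec ` {S. psd S}"

definition indicator_fun :: "'a set \<Rightarrow> 'a \<Rightarrow> ereal" where
  "indicator_fun E x = (if x \<in> E then 0 else \<infinity>)"

section \<open>The optimization problem\<close>

definition V2 :: "real^('n::finite + 'm::finite)^'n" where
  "V2 = (\<chi> i c. if c = Inl i then 1 else 0)"

definition Upsilon ::
  "real^('n::finite + 'm::finite)^('n + 'm) \<Rightarrow> real^('n + 'm)^('n + 'm) \<Rightarrow> real^('n + 'm)^('n + 'm) \<Rightarrow> real^'n^'n" where
  "Upsilon F Q W = - (V2 ** (F ** W + W ** transpose F + Q) ** transpose V2)"

definition Xi ::
  "real^('n::finite + 'm::finite)^('n + 'm) \<Rightarrow> real^(('n + 'm) \<times> ('n + 'm))^('n \<times> 'n)" where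
  "Xi F = kron V2 (V2 ** F) + kron (V2 ** F) V2"

text \<open>A point of the problem is a pair of \<open>X0\<close> and a family \<open>X\<close>, of which only the members
  with index in \<open>{1..M}\<close> matter.\<close>

definition Lstar ::
  "nat \<Rightarrow> (nat \<Rightarrow> real^('n::finite + 'm::finite)^('n + 'm)) \<Rightarrow> real^('n + 'm)^('n + 'm)
   \<Rightarrow> real^(('n + 'm) uprod)^(('n + 'm) \<times> ('n + 'm)) \<Rightarrow> real^('n \<times> 'n)^('n uprod)
   \<Rightarrow> real^(('n + 'm) uprod) \<Rightarrow> (nat \<Rightarrow> real^('n uprod)) \<Rightarrow> real^(('n + 'm) uprod)" where
  "Lstar M F R D1 T2 X0 X =
     transpose D1 *v vec_cols R - X0
     + transpose D1 *v (\<Sum>i=1..M. transpose (Xi (F i)) *v (transpose T2 *v X i))"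

definition Omega ::
  "nat \<Rightarrow> (nat \<Rightarrow> real^('n::finite + 'm::finite)^('n + 'm)) \<Rightarrow> real^('n + 'm)^('n + 'm) \<Rightarrow> real^('n + 'm)^('n + 'm)
   \<Rightarrow> real^(('n + 'm) uprod)^(('n + 'm) \<times> ('n + 'm)) \<Rightarrow> real^('n \<times> 'n)^('n uprod)
   \<Rightarrow> real \<Rightarrow> real^(('n + 'm) \<times> ('n + 'm))
   \<Rightarrow> real^(('n + 'm) uprod) \<Rightarrow> (nat \<Rightarrow> real^('n uprod)) \<Rightarrow> ereal" where
  "Omega M F Q R D1 T2 \<beta> \<xi> X0 X =
     ereal (- ((\<Sum>i=1..M. X i) \<bullet> (T2 *v (kron V2 V2 *v vec_cols Q)))
       - Lstar M F R D1 T2 X0 X \<bullet> (matrix_inv (transpose D1 ** D1) *v (transpose D1 *v \<xi>))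
       + 1 / (2 * \<beta>) *
           (norm (psd_sqrt (matrix_inv (transpose D1 ** D1)) *v Lstar M F R D1 T2 X0 X))\<^sup>2)
     + indicator_fun svec_cone X0 + (\<Sum>i=1..M. indicator_fun svec_cone (X i))"

definition Lstar_without ::
  "nat \<Rightarrow> (nat \<Rightarrow> real^('n::finite + 'm::finite)^('n + 'm)) \<Rightarrow> real^('n + 'm)^('n + 'm)
   \<Rightarrow> real^(('n + 'm) uprod)^(('n + 'm) \<times> ('n + 'm)) \<Rightarrow> real^('n \<times> 'n)^('n uprod) \<Rightarrow> nat
   \<Rightarrow> real^(('n + 'm) uprod) \<Rightarrow> (nat \<Rightarrow> real^('n uprod)) \<Rightarrow> real^(('n + 'm) uprod)" where
  "Lstar_without M F R D1 T2 i X0 X =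
     Lstar M F R D1 T2 X0 X
     - transpose D1 *v (transpose (Xi (F i)) *v (transpose T2 *v X i))"

definition Lstar_without0 ::
  "nat \<Rightarrow> (nat \<Rightarrow> real^('n::finite + 'm::finite)^('n + 'm)) \<Rightarrow> real^('n + 'm)^('n + 'm)
   \<Rightarrow> real^(('n + 'm) uprod)^(('n + 'm) \<times> ('n + 'm)) \<Rightarrow> real^('n \<times> 'n)^('n uprod)
   \<Rightarrow> real^(('n + 'm) uprod) \<Rightarrow> (nat \<Rightarrow> real^('n uprod)) \<Rightarrow> real^(('n + 'm) uprod)" where
  "Lstar_without0 M F R D1 T2 X0 X = Lstar M F R D1 T2 X0 X + X0"

definition Lmat ::
  "(nat \<Rightarrow> real^('n::finite + 'm::finite)^('n + 'm)) \<Rightarrow> real^(('n + 'm) uprod)^(('n + 'm) \<times> ('n + 'm))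
   \<Rightarrow> real^('n \<times> 'n)^('n uprod) \<Rightarrow> real \<Rightarrow> nat \<Rightarrow> real^('n uprod)^('n uprod)" where
  "Lmat F D1 T2 \<beta> i =
     (1 / \<beta>) *\<^sub>R (T2 ** Xi (F i) ** D1 ** matrix_inv (transpose D1 ** D1)
       ** transpose D1 ** transpose (Xi (F i)) ** transpose T2)"

definition Lmat0 ::
  "real^(('n::finite + 'm::finite) uprod)^(('n + 'm) \<times> ('n + 'm)) \<Rightarrow> real
   \<Rightarrow> real^(('n + 'm) uprod)^(('n + 'm) uprod)" where
  "Lmat0 D1 \<beta> = (1 / \<beta>) *\<^sub>R matrix_inv (transpose D1 ** D1)"

definition Hvec ::
  "nat \<Rightarrow> (nat \<Rightarrow> real^('n::finite + 'm::finite)^('n + 'm)) \<Rightarrow> real^('n + 'm)^('n + 'm) \<Rightarrow> real^('n + 'm)^('n + 'm)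
   \<Rightarrow> real^(('n + 'm) uprod)^(('n + 'm) \<times> ('n + 'm)) \<Rightarrow> real^('n \<times> 'n)^('n uprod)
   \<Rightarrow> real \<Rightarrow> real^(('n + 'm) \<times> ('n + 'm)) \<Rightarrow> nat
   \<Rightarrow> real^(('n + 'm) uprod) \<Rightarrow> (nat \<Rightarrow> real^('n uprod)) \<Rightarrow> real^('n uprod)" where
  "Hvec M F Q R D1 T2 \<beta> \<xi> i X0 X =
     T2 *v (kron V2 V2 *v vec_cols Q)
     + (T2 ** Xi (F i) ** D1 ** matrix_inv (transpose D1 ** D1) ** transpose D1) *v \<xi>
     - (1 / \<beta>) *\<^sub>R ((T2 ** Xi (F i) ** D1 ** matrix_inv (transpose D1 ** D1))
         *v Lstar_without M F R D1 T2 i X0 X)"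

definition Hvec0 ::
  "nat \<Rightarrow> (nat \<Rightarrow> real^('n::finite + 'm::finite)^('n + 'm)) \<Rightarrow> real^('n + 'm)^('n + 'm)
   \<Rightarrow> real^(('n + 'm) uprod)^(('n + 'm) \<times> ('n + 'm)) \<Rightarrow> real^('n \<times> 'n)^('n uprod)
   \<Rightarrow> real \<Rightarrow> real^(('n + 'm) \<times> ('n + 'm))
   \<Rightarrow> real^(('n + 'm) uprod) \<Rightarrow> (nat \<Rightarrow> real^('n uprod)) \<Rightarrow> real^(('n + 'm) uprod)" where
  "Hvec0 M F R D1 T2 \<beta> \<xi> X0 X =
     - (matrix_inv (transpose D1 ** D1) *v (transpose D1 *v \<xi>))
     + (1 / \<beta>) *\<^sub>R (matrix_inv (transpose D1 ** D1) *v Lstar_without0 M F R D1 T2 X0 X)"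

section \<open>Proximal block coordinate descent\<close>

text \<open>The common form of all points \<open>\<Delta>\<close>: \<open>L\<close> is the quadratic part of the block, \<open>H\<close> its linear
  part and \<open>x\<close> the current value of the block.\<close>

definition prox_point :: "real^'k^'k \<Rightarrow> real^'k \<Rightarrow> real^'k \<Rightarrow> real^'k" where
  "prox_point L H x =
     inverse (max_eigenvalue L) *\<^sub>R (H + max_eigenvalue L *\<^sub>R x - L *v x)"

text \<open>Blocks are updated in decreasing order. In the block families below, block i itself
  still has its old value; in a subproblem it is overwritten by the variable, and in
  \<open>Lstar_without\<close> its contribution is subtracted again.\<close>

definition mixed :: "nat \<Rightarrow> (nat \<Rightarrow> 'a) \<Rightarrow> (nat \<Rightarrow> 'a) \<Rightarrow> nat \<Rightarrow> 'a" where
  "mixed i old new = (\<lambda>j. if j \<le> i then old j else new j)"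

definition subproblem ::
  "(real^('p::finite uprod) \<Rightarrow> (nat \<Rightarrow> real^('n::finite uprod)) \<Rightarrow> ereal)
   \<Rightarrow> (nat \<Rightarrow> real^('n uprod) \<Rightarrow> real^('n uprod))
   \<Rightarrow> (nat \<Rightarrow> real^('p uprod)) \<Rightarrow> (nat \<Rightarrow> nat \<Rightarrow> real^('n uprod))
   \<Rightarrow> nat \<Rightarrow> nat \<Rightarrow> real^('n uprod) \<Rightarrow> ereal" where
  "subproblem Om S X0 X k i Y =
     Om (X0 k) ((mixed i (X k) (X (Suc k)))(i := Y))
     + ereal (1 / 2 * ((Y - X k i) \<bullet> S i (Y - X k i)))"

definition subproblem0 ::
  "(real^('p::finite uprod) \<Rightarrow> (nat \<Rightarrow> real^('n::finite uprod)) \<Rightarrow> ereal)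
   \<Rightarrow> (real^('p uprod) \<Rightarrow> real^('p uprod))
   \<Rightarrow> (nat \<Rightarrow> real^('p uprod)) \<Rightarrow> (nat \<Rightarrow> nat \<Rightarrow> real^('n uprod))
   \<Rightarrow> nat \<Rightarrow> real^('p uprod) \<Rightarrow> ereal" where
  "subproblem0 Om S0 X0 X k Y =
     Om Y (X (Suc k)) + ereal (1 / 2 * ((Y - X0 k) \<bullet> S0 (Y - X0 k)))"

text \<open>The iterates of block 0 and of the blocks \<open>{1..M}\<close> are a run of the algorithm if every new
  block solves its subproblem and the starting point lies in the domain of the objective.
  (From a starting point outside of it, a subproblem may be constantly \<open>\<infinity>\<close>.)\<close>

definition pbcd_run ::
  "nat \<Rightarrow> (real^('p::finite uprod) \<Rightarrow> (nat \<Rightarrow> real^('n::finite uprod)) \<Rightarrow> ereal)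
   \<Rightarrow> (real^('p uprod) \<Rightarrow> real^('p uprod)) \<Rightarrow> (nat \<Rightarrow> real^('n uprod) \<Rightarrow> real^('n uprod))
   \<Rightarrow> (nat \<Rightarrow> real^('p uprod)) \<Rightarrow> (nat \<Rightarrow> nat \<Rightarrow> real^('n uprod)) \<Rightarrow> bool" where
  "pbcd_run M Om S0 S X0 X \<longleftrightarrow>
     Om (X0 0) (X 0) < \<infinity> \<and>
     (\<forall>k. (\<forall>i\<in>{1..M}. is_arg_min (subproblem Om S X0 X k i) (\<lambda>_. True) (X (Suc k) i)) \<and>
          is_arg_min (subproblem0 Om S0 X0 X k) (\<lambda>_. True) (X0 (Suc k)))"

definition Delta ::
  "nat \<Rightarrow> (nat \<Rightarrow> real^('n::finite + 'm::finite)^('n + 'm)) \<Rightarrow> real^('n + 'm)^('n + 'm) \<Rightarrow> real^('n + 'm)^('n + 'm)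
   \<Rightarrow> real^(('n + 'm) uprod)^(('n + 'm) \<times> ('n + 'm)) \<Rightarrow> real^('n \<times> 'n)^('n uprod)
   \<Rightarrow> real \<Rightarrow> real^(('n + 'm) \<times> ('n + 'm))
   \<Rightarrow> (nat \<Rightarrow> real^(('n + 'm) uprod)) \<Rightarrow> (nat \<Rightarrow> nat \<Rightarrow> real^('n uprod))
   \<Rightarrow> nat \<Rightarrow> nat \<Rightarrow> real^('n uprod)" where
  "Delta M F Q R D1 T2 \<beta> \<xi> X0 X k i =
     prox_point (Lmat F D1 T2 \<beta> i)
       (Hvec M F Q R D1 T2 \<beta> \<xi> i (X0 k) (mixed i (X k) (X (Suc k)))) (X k i)"

definition Delta0 ::
  "nat \<Rightarrow> (nat \<Rightarrow> real^('n::finite + 'm::finite)^('n + 'm)) \<Rightarrow> real^('n + 'm)^('n + 'm)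
   \<Rightarrow> real^(('n + 'm) uprod)^(('n + 'm) \<times> ('n + 'm)) \<Rightarrow> real^('n \<times> 'n)^('n uprod)
   \<Rightarrow> real \<Rightarrow> real^(('n + 'm) \<times> ('n + 'm))
   \<Rightarrow> (nat \<Rightarrow> real^(('n + 'm) uprod)) \<Rightarrow> (nat \<Rightarrow> nat \<Rightarrow> real^('n uprod))
   \<Rightarrow> nat \<Rightarrow> real^(('n + 'm) uprod)" where
  "Delta0 M F R D1 T2 \<beta> \<xi> X0 X k =
     prox_point (Lmat0 D1 \<beta>) (Hvec0 M F R D1 T2 \<beta> \<xi> (X0 k) (X (Suc k))) (X0 k)"

end

theory Submission
  imports Defs
begin

text \<open>As a function of a single block \<open>Y\<close>, the smooth part of the objective is a quadratic
  \<open>1/2 * (Y \<bullet> L Y) - Y \<bullet> H\<close> plus a constant, where \<open>L\<close> is the matrix of the block and \<open>H\<close>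
  its vector. Take \<open>\<rho> I - L\<close> for the operator of the block, with \<open>\<rho>\<close> the largest eigenvalue of
  \<open>L\<close>. It is positive semidefinite, because \<open>\<rho>\<close> bounds the Rayleigh quotient of the symmetric
  matrix \<open>L\<close>. The proximal term at \<open>x\<close> then replaces \<open>L\<close> by \<open>\<rho> I\<close>: the smooth part of the
  subproblem is \<open>\<rho>/2 * (norm (Y - \<Delta>))\<^sup>2\<close> plus a constant, with
  \<open>\<rho> \<Delta> = H + \<rho> x - L x\<close> (\<open>linearized_quadratic\<close>). If \<open>\<rho> > 0\<close>, its only minimizer
  over the cone is the projection of \<open>\<Delta>\<close>, as the cone is closed, convex and nonempty
  (\<open>closest_point_is_arg_min\<close>).

  Four points remain.

  \<^item> The matrix \<open>transpose D1 ** D1\<close> is diagonal with positive entries, so its inverse and the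
    square root in the objective are what they should be (\<open>duplication_gram_inverse\<close>; the
    square root is characterized by its uniqueness, \<open>psd_sqrt_unique\<close>).

  \<^item> Every \<open>\<rho>\<close> is positive, that is, \<open>L\<close> is nonzero. For block 0 this is clear. For the other
    blocks it follows from strict feasibility together with the definiteness of
    \<open>B1 ** transpose B1\<close> (\<open>strictly_feasible_imp_nonzero\<close>).

  \<^item> If another block lies outside of its cone, then the subproblem is constantly \<open>\<infinity>\<close>; every
    point is a minimizer then, in particular the projection.

  \<^item> A run starts in the domain of the objective and, by the above, stays in it, so that each of
    its subproblems has a unique minimizer (\<open>pbcd_run_closed_form\<close>).\<close>

section \<open>Symmetric matrices\<close>

lemma inner_matrix_vector_transpose:
  fixes A :: "real^'a^'b"
  shows "(A *v x) \<bullet> y = x \<bullet> (transpose A *v y)"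
  by (metis dot_lmul_matrix inner_commute transpose_matrix_vector)

lemma inner_symmetric_matrix:
  fixes A :: "real^'a^'a"
  assumes "transpose A = A"
  shows "(A *v x) \<bullet> y = x \<bullet> (A *v y)"
  using inner_matrix_vector_transpose[of A x y] assms by simp

lemma transpose_diff: "transpose (A - B) = transpose A - transpose (B :: real^'a^'b)"
  by (simp add: transpose_def vec_eq_iff)

lemma psd_null_vector:
  assumes "psd S" and "x \<bullet> (S *v x) = 0"
  shows "S *v x = 0"
proof -
  define w where "w = S *v x"
  define a where "a = w \<bullet> w"
  define b where "b = w \<bullet> (S *v w)"
  have sym: "transpose S = S" and nn: "\<And>y. 0 \<le> y \<bullet> (S *v y)"
    using assms(1) by (auto simp: psd_def)
  have expand: "0 \<le> t * t * b - 2 * t * a" for t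
  proof -
    have "x \<bullet> (S *v w) = a"
      using inner_symmetric_matrix[OF sym, of x w] by (simp add: w_def a_def)
    moreover have "0 \<le> (x - t *\<^sub>R w) \<bullet> (S *v (x - t *\<^sub>R w))"
      by (rule nn)
    ultimately show ?thesis
      using assms(2)
      by (simp add: matrix_vector_mult_diff_distrib matrix_vector_mult_scaleR inner_diff_left
          inner_diff_right b_def w_def[symmetric] a_def[symmetric] algebra_simps)
  qed
  have "0 \<le> b" unfolding b_def by (rule nn)
  have "a \<le> 0"
  proof (rule ccontr)
    assume "\<not> a \<le> 0"
    then have "a > 0" by simp
    \<comment> \<open>If \<open>a > 0\<close>, then at \<open>t = a / (b + 1)\<close> the quadratic in \<open>t\<close> is negative; adding 1 avoids a
      case distinction on \<open>b = 0\<close>.\<close>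
    have "0 \<le> a / (b + 1) * (a / (b + 1) * b - 2 * a)"
      using expand[of "a / (b + 1)"] by (simp add: algebra_simps)
    moreover have "a / (b + 1) > 0" using \<open>a > 0\<close> \<open>0 \<le> b\<close> by simp
    ultimately have "0 \<le> a / (b + 1) * b - 2 * a"
      unfolding zero_le_mult_iff by linarith
    then have "2 * a \<le> a / (b + 1) * b" by linarith
    also have "\<dots> \<le> a"
      using \<open>a > 0\<close> \<open>0 \<le> b\<close> by (simp add: field_simps)
    finally show False using \<open>a > 0\<close> by simp
  qed
  then have "w = 0" unfolding a_def by (metis inner_gt_zero_iff not_less)
  then show ?thesis by (simp add: w_def)
qed

lemma symmetric_eigenvalues_finite:
  fixes A :: "real^'k^'k"
  assumes sym: "transpose A = A"
  shows "finite {a. eigenvalue A a}"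
proof -
  define v where "v a = (SOME v. v \<noteq> 0 \<and> A *v v = a *s v)" for a
  have v: "v a \<noteq> 0" "A *v v a = a *\<^sub>R v a" if "eigenvalue A a" for a
  proof -
    have "v a \<noteq> 0 \<and> A *v v a = a *s v a"
      using that unfolding eigenvalue_def v_def by (rule someI_ex)
    then show "v a \<noteq> 0" "A *v v a = a *\<^sub>R v a"
      by (auto simp: scalar_mult_eq_scaleR)
  qed
  have orth: "v a \<bullet> v b = 0" if "eigenvalue A a" "eigenvalue A b" "a \<noteq> b" for a b
  proof -
    have "a * (v a \<bullet> v b) = b * (v a \<bullet> v b)"
      using inner_symmetric_matrix[OF sym, of "v a" "v b"] v that by simp
    then show ?thesis using that by simp
  qed
  have "inj_on v {a. eigenvalue A a}"
  proof (rule inj_onI)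
    fix a b assume *: "a \<in> {a. eigenvalue A a}" "b \<in> {a. eigenvalue A a}" "v a = v b"
    show "a = b"
    proof (rule ccontr)
      assume "a \<noteq> b"
      then have "v b \<bullet> v b = 0" using orth[of a b] * by simp
      then show False using * v(1)[of b] by simp
    qed
  qed
  moreover have "finite (v ` {a. eigenvalue A a})"
  proof (rule pairwise_orthogonal_imp_finite)
    show "pairwise orthogonal (v ` {a. eigenvalue A a})"
      using orth by (auto simp: pairwise_def orthogonal_def)
  qed
  ultimately show ?thesis by (rule finite_imageD[rotated])
qed

text \<open>A maximizer \<open>v\<close> of the quadratic form over the unit sphere, with maximum \<open>r\<close>, is a null
  vector of the form of \<open>r I - A\<close>. That matrix is positive semidefinite, hence \<open>v\<close> is in its
  kernel.\<close>

lemma symmetric_rayleigh_max: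
  fixes A :: "real^'k^'k"
  assumes sym: "transpose A = A"
  obtains r where "eigenvalue A r" and "\<And>x. x \<bullet> (A *v x) \<le> r * (x \<bullet> x)"
proof -
  have "continuous_on (sphere 0 1) (\<lambda>x. x \<bullet> (A *v x))"
    by (intro continuous_intros linear_continuous_on matrix_vector_mul_bounded_linear)
  moreover have "sphere (0::real^'k) 1 \<noteq> {}" by simp
  ultimately obtain v where v: "v \<in> sphere 0 1"
    and max: "\<And>y. y \<in> sphere 0 1 \<Longrightarrow> y \<bullet> (A *v y) \<le> v \<bullet> (A *v v)"
    using continuous_attains_sup[OF compact_sphere] by blast
  define r where "r = v \<bullet> (A *v v)"
  have bound: "x \<bullet> (A *v x) \<le> r * (x \<bullet> x)" for x
  proof (cases "x = 0")
    case False
    define y where "y = (1 / norm x) *\<^sub>R x"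
    have "y \<in> sphere 0 1" using False by (simp add: y_def)
    then have "y \<bullet> (A *v y) \<le> r" using max r_def by simp
    moreover have "y \<bullet> (A *v y) = (x \<bullet> (A *v x)) / (norm x)\<^sup>2"
      by (simp add: y_def matrix_vector_mult_scaleR power2_eq_square)
    ultimately have "x \<bullet> (A *v x) \<le> r * (norm x)\<^sup>2"
      using False by (simp add: divide_le_eq)
    then show ?thesis by (simp add: dot_square_norm)
  qed simp
  define N where "N = r *\<^sub>R mat 1 - A"
  have N: "N *v x = r *\<^sub>R x - A *v x" for x
    by (simp add: N_def matrix_vector_mult_diff_rdistrib scaleR_matrix_vector_assoc[symmetric])
  have "transpose N = N"
    using sym by (auto simp: N_def transpose_def vec_eq_iff mat_def)
  then have "psd N"
    using bound by (auto simp: psd_def N inner_diff_right)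
  moreover have "v \<bullet> (N *v v) = 0"
    using v by (simp add: N inner_diff_right r_def dot_square_norm)
  ultimately have "N *v v = 0" by (rule psd_null_vector)
  then have "A *v v = r *s v" by (simp add: N scalar_mult_eq_scaleR)
  moreover have "v \<noteq> 0" using v by auto
  ultimately have "eigenvalue A r" by (auto simp: eigenvalue_def)
  then show ?thesis using bound that by blast
qed

lemma max_eigenvalue_bound:
  fixes A :: "real^'k^'k"
  assumes "transpose A = A"
  shows "x \<bullet> (A *v x) \<le> max_eigenvalue A * (x \<bullet> x)"
proof -
  obtain r where "eigenvalue A r" and r: "x \<bullet> (A *v x) \<le> r * (x \<bullet> x)"
    using symmetric_rayleigh_max[OF assms] by metis
  then have "r \<le> max_eigenvalue A"
    unfolding max_eigenvalue_def using symmetric_eigenvalues_finite[OF assms] by simp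
  then have "r * (x \<bullet> x) \<le> max_eigenvalue A * (x \<bullet> x)"
    by (rule mult_right_mono) simp
  with r show ?thesis by simp
qed

lemma max_eigenvalue_pos:
  fixes A :: "real^'k^'k"
  assumes "psd A" and "A \<noteq> 0"
  shows "max_eigenvalue A > 0"
proof (rule ccontr)
  assume "\<not> max_eigenvalue A > 0"
  then have neg: "max_eigenvalue A \<le> 0" by simp
  have "A *v x = 0" for x
  proof (rule psd_null_vector[OF assms(1)])
    have "x \<bullet> (A *v x) \<le> max_eigenvalue A * (x \<bullet> x)"
      using assms(1) by (intro max_eigenvalue_bound) (simp add: psd_def)
    also have "\<dots> \<le> 0" using neg by (simp add: mult_nonpos_nonneg)
    finally show "x \<bullet> (A *v x) = 0" using assms(1) by (simp add: psd_def antisym)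
  qed
  then have "A = 0" by (simp add: matrix_eq)
  with assms(2) show False ..
qed

lemma symmetric_eq_zero:
  fixes A :: "real^'k^'k"
  assumes sym: "transpose A = A" and eig: "\<And>a. eigenvalue A a \<Longrightarrow> a = 0"
  shows "A = 0"
proof -
  have sym': "transpose (- A) = - A"
    using sym by (simp add: transpose_def vec_eq_iff)
  have neg: "(- A) *v x = - (A *v x)" for x
    using matrix_vector_mult_diff_rdistrib[of 0 A x] by simp
  have eig': "a = 0" if "eigenvalue (- A) a" for a
  proof -
    from that obtain v where "v \<noteq> 0" "- (A *v v) = a *\<^sub>R v"
      by (auto simp: eigenvalue_def neg scalar_mult_eq_scaleR)
    then have "eigenvalue A (- a)"
      unfolding eigenvalue_def scalar_mult_eq_scaleR
      by (intro exI[of _ v]) (metis minus_minus scaleR_minus_left)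
    then show ?thesis using eig by fastforce
  qed
  have le: "x \<bullet> (A *v x) \<le> 0" for x
    using symmetric_rayleigh_max[OF sym] eig by (metis mult_zero_left)
  have ge: "x \<bullet> ((- A) *v x) \<le> 0" for x
    using symmetric_rayleigh_max[OF sym'] eig' by (metis mult_zero_left)
  have null: "x \<bullet> (A *v x) = 0" for x
    using le[of x] ge[of x] by (simp add: neg)
  then have "psd A" using sym by (simp add: psd_def)
  then have "A *v x = 0" for x using null by (rule psd_null_vector)
  then show ?thesis by (simp add: matrix_eq)
qed

text \<open>If \<open>B\<close> and \<open>C\<close> have the same square, then
  \<open>(B - C)(B + C) + (B + C)(B - C) = 0\<close>. Evaluating this form at an eigenvector of \<open>B - C\<close>
  shows that its eigenvalue is 0.\<close>

lemma psd_sqrt_unique: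
  fixes B C :: "real^'k^'k"
  assumes B: "psd B" and C: "psd C" and eq: "B ** B = C ** C"
  shows "B = C"
proof -
  have symB: "transpose B = B" and symC: "transpose C = C"
    using B C by (simp_all add: psd_def)
  have "B - C = 0"
  proof (rule symmetric_eq_zero)
    show "transpose (B - C) = B - C"
      by (simp add: transpose_diff symB symC)
    fix a assume "eigenvalue (B - C) a"
    then obtain v where v: "v \<noteq> 0" and "(B - C) *v v = a *\<^sub>R v"
      unfolding eigenvalue_def scalar_mult_eq_scaleR by blast
    then have Bv: "B *v v = C *v v + a *\<^sub>R v"
      by (simp add: matrix_vector_mult_diff_rdistrib diff_eq_eq add.commute)
    have sq: "(B *v v) \<bullet> (B *v v) = (C *v v) \<bullet> (C *v v)"
    proof -
      have "v \<bullet> ((B ** B) *v v) = v \<bullet> ((C ** C) *v v)" by (simp add: eq)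
      then show ?thesis
        by (simp add: matrix_vector_mul_assoc[symmetric] inner_symmetric_matrix[OF symB, of v]
            inner_symmetric_matrix[OF symC, of v])
    qed
    have "a * (v \<bullet> (B *v v) + v \<bullet> (C *v v)) = 0"
    proof -
      have "(B *v v - C *v v) \<bullet> (B *v v + C *v v) = 0"
        using sq by (simp add: inner_diff_left inner_diff_right inner_add_right inner_commute)
      moreover have "B *v v - C *v v = a *\<^sub>R v" using Bv by simp
      ultimately show ?thesis by (simp only: inner_scaleR_left inner_add_right distrib_left)
    qed
    moreover have "a * (v \<bullet> v) = v \<bullet> (B *v v) - v \<bullet> (C *v v)"
      by (simp add: Bv inner_add_right)
    moreover have "0 \<le> v \<bullet> (B *v v)" "0 \<le> v \<bullet> (C *v v)"
      using B C by (auto simp: psd_def)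
    ultimately show "a = 0" using v by (auto simp: add_nonneg_eq_0_iff)
  qed
  then show ?thesis by simp
qed

lemma psd_sqrt_eqI:
  assumes "psd B" and "B ** B = A"
  shows "psd_sqrt A = B"
  unfolding psd_sqrt_def using assms psd_sqrt_unique by (intro the_equality) auto

section \<open>Vectorized symmetric matrices\<close>

text \<open>The symmetric matrix with given entries in one triangle; this inverts \<open>svec\<close>.\<close>

definition smat :: "real^('k uprod) \<Rightarrow> real^'k^'k" where
  "smat x = (\<chi> i j. x $ Upair i j)"

lemma smat_nth [simp]: "smat x $ i $ j = x $ Upair i j"
  by (simp add: smat_def)

lemma transpose_smat [simp]: "transpose (smat x) = smat x"
proof -
  have "x $ Upair j i = x $ Upair i j" for i j
    by (rule arg_cong[where f = "\<lambda>u. x $ u"]) simp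
  then show ?thesis unfolding transpose_def vec_eq_iff by simp
qed

lemma svec_Upair:
  assumes "transpose S = S"
  shows "svec S $ Upair i j = S $ i $ j"
proof -
  have sym: "S $ a $ b = S $ b $ a" for a b
    using assms by (metis transpose_def vec_lambda_beta)
  show ?thesis
    unfolding svec_def vec_lambda_beta
    by (rule the_equality) (use sym in auto)
qed

lemma svec_smat [simp]: "svec (smat x) = x"
proof -
  have "svec (smat x) $ u = x $ u" for u
    by (cases u) (simp add: svec_Upair)
  then show ?thesis by (simp add: vec_eq_iff)
qed

lemma smat_svec: "transpose S = S \<Longrightarrow> smat (svec S) = S"
  by (simp add: vec_eq_iff svec_Upair)

lemma svec_cone_eq: "svec_cone = {x. psd (smat x)}"
proof -
  have "smat (svec S) = S" if "psd S" for S :: "real^'a^'a"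
    using that smat_svec by (auto simp: psd_def)
  then show ?thesis
    unfolding svec_cone_def by (auto intro!: image_eqI[where x = "smat _"])
qed

lemma linear_smat_quadratic: "linear (\<lambda>x. y \<bullet> (smat x *v y))"
proof (rule linearI)
  fix a b :: "real^('a uprod)" and c :: real
  have add: "smat (a + b) = smat a + smat b" by (simp add: vec_eq_iff)
  have scale: "smat (c *\<^sub>R a) = c *\<^sub>R smat a" by (simp add: vec_eq_iff)
  show "y \<bullet> (smat (a + b) *v y) = y \<bullet> (smat a *v y) + y \<bullet> (smat b *v y)"
    by (simp add: add matrix_vector_mult_add_rdistrib inner_add_right)
  show "y \<bullet> (smat (c *\<^sub>R a) *v y) = c *\<^sub>R (y \<bullet> (smat a *v y))"
    by (simp add: scale scaleR_matrix_vector_assoc[symmetric])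
qed

lemma svec_cone_halfspaces:
  "svec_cone = (\<Inter>y. (\<lambda>x. y \<bullet> (smat x *v y)) -` {0..})"
  by (auto simp: svec_cone_eq psd_def)

lemma closed_svec_cone: "closed (svec_cone :: (real^('k::finite uprod)) set)"
  unfolding svec_cone_halfspaces
  by (intro closed_INT ballI closed_vimage linear_continuous_on closed_atLeast
      linear_smat_quadratic linear_conv_bounded_linear[THEN iffD1])

lemma convex_svec_cone: "convex (svec_cone :: (real^('k::finite uprod)) set)"
  unfolding svec_cone_halfspaces
  by (intro convex_INT convex_linear_vimage linear_smat_quadratic) simp

lemma svec_cone_nonempty: "(svec_cone :: (real^('k::finite uprod)) set) \<noteq> {}"
proof -
  have "psd (smat 0 :: real^'k^'k)"
    by (auto simp: psd_def inner_vec_def matrix_vector_mult_def)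
  then show ?thesis by (auto simp: svec_cone_eq)
qed

lemma closest_point_in_svec_cone:
  "closest_point svec_cone x \<in> (svec_cone :: (real^('k::finite uprod)) set)"
  using closed_svec_cone svec_cone_nonempty by (rule closest_point_in_set)

lemma kron_vec_cols:
  "kron A B *v vec_cols X = vec_cols (B ** X ** transpose A)"
proof -
  have "(kron A B *v vec_cols X) $ (a, c) = (B ** X ** transpose A) $ c $ a" for a c
  proof -
    have "(kron A B *v vec_cols X) $ (a, c)
        = (\<Sum>(b, d)\<in>UNIV \<times> UNIV. A $ a $ b * B $ c $ d * X $ d $ b)"
      by (simp add: kron_def vec_cols_def matrix_vector_mult_def case_prod_beta)
    also have "\<dots> = (\<Sum>b\<in>UNIV. \<Sum>d\<in>UNIV. A $ a $ b * B $ c $ d * X $ d $ b)"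
      by (simp add: sum.cartesian_product)
    also have "\<dots> = (B ** X ** transpose A) $ c $ a"
      by (simp add: matrix_matrix_mult_def transpose_def sum_distrib_left sum_distrib_right
          ac_simps)
    finally show ?thesis .
  qed
  then show ?thesis by (auto simp: vec_eq_iff vec_cols_def)
qed

lemma matrix_add_rdistrib: "(A + B) ** C = A ** C + B ** (C :: real^'a^'b)"
  by (simp add: matrix_matrix_mult_def vec_eq_iff distrib_right sum.distrib)

lemma vec_cols_add: "vec_cols (X + Y) = vec_cols X + vec_cols Y"
  by (simp add: vec_cols_def vec_eq_iff)

lemma Xi_vec_cols:
  "Xi F *v vec_cols W
    = vec_cols (V2 ** (F ** W + W ** transpose F) ** transpose V2)"
proof -
  have "V2 ** F ** W ** transpose V2 + V2 ** W ** transpose (V2 ** F)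
      = V2 ** (F ** W + W ** transpose F) ** transpose V2"
    by (simp add: matrix_transpose_mul matrix_add_ldistrib matrix_add_rdistrib matrix_mul_assoc)
  then show ?thesis
    by (simp add: Xi_def matrix_vector_mult_add_rdistrib kron_vec_cols flip: vec_cols_add)
qed

section \<open>The Gram matrix of the duplication matrix\<close>

text \<open>The matrix that recovers the full vectorization of a symmetric matrix from one triangle.
  The condition determines it, since \<open>svec\<close> maps the symmetric matrices onto the whole space.\<close>

definition duplication_matrix :: "real^('k::finite uprod)^('k \<times> 'k) \<Rightarrow> bool" where
  "duplication_matrix E \<longleftrightarrow> (\<forall>W. transpose W = W \<longrightarrow> vec_cols W = E *v svec W)"

lemma duplication_matrix_nth:
  fixes E :: "real^('k::finite uprod)^('k \<times> 'k)"
  assumes "duplication_matrix E"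
  shows "E $ p $ u = (if u = Upair (fst p) (snd p) then 1 else 0)"
proof -
  have "vec_cols (smat (axis u 1)) = E *v axis u 1"
    using assms by (metis duplication_matrix_def svec_smat transpose_smat)
  then have "E $ p $ u = vec_cols (smat (axis u 1)) $ p"
    by (simp add: matrix_vector_mult_basis column_def)
  also have "\<dots> = axis u 1 $ Upair (snd p) (fst p)"
    by (simp add: vec_cols_def)
  also have "Upair (snd p) (fst p) = Upair (fst p) (snd p)" by simp
  finally show ?thesis by (auto simp: axis_def)
qed

text \<open>The diagonal matrix with given diagonal.\<close>

definition diag_mat :: "('k \<Rightarrow> real) \<Rightarrow> real^'k^'k" where
  "diag_mat d = (\<chi> i j. if i = j then d i else 0)"

lemma transpose_diag_mat [simp]: "transpose (diag_mat d) = diag_mat d"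
  by (auto simp: diag_mat_def transpose_def vec_eq_iff)

lemma diag_mat_mult: "diag_mat d ** diag_mat e = diag_mat (\<lambda>i. d i * e i)"
  by (auto simp: diag_mat_def matrix_matrix_mult_def vec_eq_iff if_distrib[of "\<lambda>x. x * _"]
      cong: if_cong)

lemma diag_mat_one: "diag_mat (\<lambda>_. 1) = mat 1"
  by (simp add: diag_mat_def mat_def)

lemma diag_mat_vec: "(diag_mat d *v x) $ i = d i * x $ i"
  by (simp add: diag_mat_def matrix_vector_mult_def if_distrib[of "\<lambda>x. x * _"] cong: if_cong)

lemma diag_mat_quadratic: "x \<bullet> (diag_mat d *v x) = (\<Sum>i\<in>UNIV. d i * (x $ i)\<^sup>2)"
  by (simp add: inner_vec_def diag_mat_vec power2_eq_square ac_simps)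

lemma psd_diag_mat: "(\<And>i. 0 \<le> d i) \<Longrightarrow> psd (diag_mat d)"
  by (simp add: psd_def diag_mat_quadratic sum_nonneg)

lemma pd_diag_mat:
  assumes "\<And>i. 0 < d i"
  shows "pd (diag_mat d)"
proof -
  have "0 < x \<bullet> (diag_mat d *v x)" if "x \<noteq> 0" for x
  proof -
    from that obtain i where "x $ i \<noteq> 0" by (auto simp: vec_eq_iff)
    then show ?thesis
      unfolding diag_mat_quadratic using assms
      by (intro sum_pos2[of _ i]) (auto simp: less_imp_le)
  qed
  then show ?thesis by (simp add: pd_def)
qed

lemma matrix_inv_eqI:
  fixes A B :: "real^'k^'k"
  assumes "A ** B = mat 1" and "B ** A = mat 1"
  shows "matrix_inv A = B"
proof -
  have inv: "A ** matrix_inv A = mat 1 \<and> matrix_inv A ** A = mat 1"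
    unfolding matrix_inv_def by (rule someI[of _ B]) (simp add: assms)
  have "matrix_inv A = matrix_inv A ** (A ** B)" by (simp add: assms(1))
  also have "\<dots> = (matrix_inv A ** A) ** B" by (simp only: matrix_mul_assoc)
  also have "\<dots> = B" by (simp add: inv)
  finally show ?thesis .
qed

text \<open>The Gram matrix is diagonal (with entries 1 and 2), so its inverse and the square root
  of the inverse are diagonal as well.\<close>

lemma duplication_gram_inverse:
  fixes E :: "real^('k::finite uprod)^('k \<times> 'k)"
  assumes E: "duplication_matrix E"
  defines "G \<equiv> matrix_inv (transpose E ** E)"
  shows "pd G" and "(psd_sqrt G *v x) \<bullet> (psd_sqrt G *v x) = x \<bullet> (G *v x)"
proof -
  define d where "d u = real (card {p. u = Upair (fst p) (snd p)})" for u :: "'k uprod"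
  have d: "d u > 0" for u
  proof -
    obtain a b where "u = Upair a b" by (cases u)
    then have "(a, b) \<in> {p. u = Upair (fst p) (snd p)}" by simp
    then have "{p. u = Upair (fst p) (snd p)} \<noteq> {}" by (simp only: ex_in_conv[symmetric]) (rule exI)
    then show ?thesis unfolding d_def of_nat_0_less_iff card_gt_0_iff by (rule conjI[OF _ finite])
  qed
  have "(transpose E ** E) $ u $ v = diag_mat d $ u $ v" for u v
  proof -
    have "(transpose E ** E) $ u $ v = (\<Sum>p\<in>UNIV. E $ p $ u * E $ p $ v)"
      by (simp add: matrix_matrix_mult_def transpose_def)
    also have "\<dots> = diag_mat d $ u $ v"
    proof (cases "u = v")
      case True
      have "(\<Sum>p\<in>UNIV. E $ p $ u * E $ p $ u)
          = (\<Sum>p\<in>UNIV. if p \<in> {p. u = Upair (fst p) (snd p)} then 1 else 0)"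
        by (intro sum.cong) (simp_all add: duplication_matrix_nth[OF E])
      also have "\<dots> = d u"
        unfolding d_def by (subst sum.If_cases) simp_all
      finally show ?thesis using True by (simp add: diag_mat_def)
    next
      case False
      have "E $ p $ u * E $ p $ v = 0" for p
        using False
        by (cases "u = Upair (fst p) (snd p)") (simp_all add: duplication_matrix_nth[OF E])
      then have "(\<Sum>p\<in>UNIV. E $ p $ u * E $ p $ v) = 0" by (simp only: sum.neutral_const)
      then show ?thesis using False by (simp add: diag_mat_def)
    qed
    finally show ?thesis .
  qed
  then have gram: "transpose E ** E = diag_mat d" by (simp add: vec_eq_iff)
  have nz: "d u \<noteq> 0" for u using d[of u] by simp
  have G: "G = diag_mat (\<lambda>u. 1 / d u)"
    unfolding G_def gram
    by (rule matrix_inv_eqI) (simp_all add: diag_mat_mult nz diag_mat_one)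
  then show "pd G" using d by (simp add: pd_diag_mat)
  define H where "H = diag_mat (\<lambda>u. 1 / sqrt (d u))"
  have "H ** H = G"
    using d by (simp add: H_def G diag_mat_mult less_imp_le)
  have "psd H" unfolding H_def using d by (intro psd_diag_mat) (simp add: less_imp_le)
  have "psd_sqrt G = H" using \<open>psd H\<close> \<open>H ** H = G\<close> by (rule psd_sqrt_eqI)
  moreover have "(H *v x) \<bullet> (H *v x) = x \<bullet> ((H ** H) *v x)"
    using inner_symmetric_matrix[of H x "H *v x"] by (simp add: H_def matrix_vector_mul_assoc)
  ultimately show "(psd_sqrt G *v x) \<bullet> (psd_sqrt G *v x) = x \<bullet> (G *v x)"
    by (simp only: \<open>H ** H = G\<close>)
qed

section \<open>Proximal steps\<close>

text \<open>Adding the proximal term makes the quadratic isotropic, with its center at the proximal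
  point; completing the square leaves the constant on the right.\<close>

lemma linearized_quadratic:
  fixes L :: "real^'k^'k"
  assumes sym: "transpose L = L" and "max_eigenvalue L \<noteq> 0"
  defines "\<rho> \<equiv> max_eigenvalue L"
  shows "1 / 2 * (y \<bullet> (L *v y)) - y \<bullet> h + 1 / 2 * ((y - x) \<bullet> (\<rho> *\<^sub>R (y - x) - L *v (y - x)))
    = \<rho> / 2 * (norm (y - prox_point L h x))\<^sup>2
      + (1 / 2 * (x \<bullet> (\<rho> *\<^sub>R x - L *v x)) - \<rho> / 2 * (norm (prox_point L h x))\<^sup>2)"
proof -
  define D where "D = prox_point L h x"
  have "\<rho> *\<^sub>R D = h + \<rho> *\<^sub>R x - L *v x"
    using assms(2) by (simp add: D_def prox_point_def \<rho>_def)
  then have h: "h = \<rho> *\<^sub>R D - \<rho> *\<^sub>R x + L *v x" by simp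
  have c: "x \<bullet> (L *v y) = y \<bullet> (L *v x)"
    using inner_symmetric_matrix[OF sym, of x y] by (simp add: inner_commute)
  show ?thesis
    unfolding D_def[symmetric] power2_norm_eq_inner
    unfolding h
    by (simp add: matrix_vector_mult_diff_distrib inner_diff_left inner_diff_right
        inner_add_right inner_commute[of D y] inner_commute[of x y] c algebra_simps)
qed

text \<open>The constant \<open>r\<close> collects the indicator functions of the other blocks and may be
  \<open>\<infinity>\<close>; in that case every point is a minimizer, and only the first claim holds.\<close>

lemma closest_point_is_arg_min:
  fixes f :: "'a::euclidean_space \<Rightarrow> ereal"
  assumes E: "closed E" "convex E" "E \<noteq> {}" and "\<rho> > 0"
    and f: "\<And>y. f y = ereal (\<rho> / 2 * (norm (y - z))\<^sup>2 + c) + indicator_fun E y + r"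
    and r: "r \<noteq> - \<infinity>"
  shows "is_arg_min f (\<lambda>_. True) (closest_point E z)"
    and "r < \<infinity> \<Longrightarrow> is_arg_min f (\<lambda>_. True) y \<Longrightarrow> y = closest_point E z"
proof -
  define p where "p = closest_point E z"
  have p: "p \<in> E" unfolding p_def using E by (rule_tac closest_point_in_set)
  have le: "norm (p - z) \<le> norm (y - z)" if "y \<in> E" for y
    using closest_point_le[OF E(1) that, of z] by (simp add: p_def dist_norm norm_minus_commute)
  have min: "f p \<le> f y" for y
  proof (cases "y \<in> E")
    case True
    then have "\<rho> / 2 * (norm (p - z))\<^sup>2 \<le> \<rho> / 2 * (norm (y - z))\<^sup>2"
      using le \<open>\<rho> > 0\<close> by (intro mult_left_mono power_mono) auto
    then show ?thesis using True p by (simp add: f indicator_fun_def add_right_mono)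
  next
    case False
    then show ?thesis using r by (simp add: f indicator_fun_def)
  qed
  then show "is_arg_min f (\<lambda>_. True) (closest_point E z)"
    by (simp add: is_arg_min_linorder p_def)
  assume "r < \<infinity>" and y: "is_arg_min f (\<lambda>_. True) y"
  then obtain r' where r': "r = ereal r'" using r by (cases r) auto
  have *: "f y \<le> f p" using y by (simp add: is_arg_min_linorder)
  then have "y \<in> E" using p by (auto simp: f indicator_fun_def r' split: if_splits)
  with * p have "\<rho> / 2 * (norm (y - z))\<^sup>2 \<le> \<rho> / 2 * (norm (p - z))\<^sup>2"
    by (simp add: f indicator_fun_def r')
  then have "norm (y - z) \<le> norm (p - z)" using \<open>\<rho> > 0\<close> by (simp add: power2_le_iff_abs_le)
  then have "\<forall>w\<in>E. dist z y \<le> dist z w"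
    using le by (force simp: dist_norm norm_minus_commute)
  with \<open>y \<in> E\<close> show "y = closest_point E z"
    using E by (intro closest_point_unique)
qed


text \<open>The objective depends on each block through an affine function \<open>l + k y\<close>. For the blocks
  with positive index, \<open>k\<close> is a matrix and \<open>k'\<close> its transpose; for block 0 both are the
  negation.\<close>

lemma quadratic_of_affine:
  fixes G :: "real^'b^'b" and k :: "'a::real_inner \<Rightarrow> real^'b"
  assumes sym: "transpose G = G" and adj: "\<And>x z. x \<bullet> k' z = k x \<bullet> z"
  shows "- (y \<bullet> q) - (l + k y) \<bullet> g + 1 / (2 * \<beta>) * ((l + k y) \<bullet> (G *v (l + k y)))
    = 1 / 2 * (y \<bullet> ((1 / \<beta>) *\<^sub>R k' (G *v k y)))
      - y \<bullet> (q + k' g - (1 / \<beta>) *\<^sub>R k' (G *v l))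
      + (1 / (2 * \<beta>) * (l \<bullet> (G *v l)) - l \<bullet> g)"
proof -
  have c: "l \<bullet> (G *v k y) = k y \<bullet> (G *v l)"
    using inner_symmetric_matrix[OF sym, of l "k y"] by (simp add: inner_commute)
  show ?thesis
    by (simp add: matrix_vector_right_distrib inner_add_left inner_add_right inner_diff_right
        adj c distrib_left)
qed

text \<open>The operator of the proximal term of a block with quadratic part \<open>L\<close>: multiplication by
  \<open>\<rho> I - L\<close>, where \<open>\<rho>\<close> is the largest eigenvalue of \<open>L\<close>.\<close>

definition prox_operator :: "real^'k^'k \<Rightarrow> real^'k \<Rightarrow> real^'k" where
  "prox_operator L y = max_eigenvalue L *\<^sub>R y - L *v y"

lemma psd_prox_operator:
  assumes "transpose L = L"
  shows "psd_operator (prox_operator L)"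
proof -
  have "linear (prox_operator L)"
    by (rule linearI) (simp_all add: prox_operator_def matrix_vector_right_distrib
        matrix_vector_mult_scaleR algebra_simps)
  moreover have "prox_operator L x \<bullet> y = x \<bullet> prox_operator L y" for x y
    by (simp add: prox_operator_def inner_diff_left inner_diff_right
        inner_symmetric_matrix[OF assms])
  moreover have "0 \<le> x \<bullet> prox_operator L x" for x
    using max_eigenvalue_bound[OF assms, of x] by (simp add: prox_operator_def inner_diff_right)
  ultimately show ?thesis by (simp add: psd_operator_def)
qed

lemma prox_block_step:
  fixes L :: "real^('k::finite uprod)^('k uprod)"
  assumes L: "psd L" "L \<noteq> 0" and r: "r \<ge> 0"
    and f: "\<And>y. f y = ereal (1 / 2 * (y \<bullet> (L *v y)) - y \<bullet> h + c) + indicator_fun svec_cone y + r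
      + ereal (1 / 2 * ((y - x) \<bullet> prox_operator L (y - x)))"
  shows "is_arg_min f (\<lambda>_. True) (closest_point svec_cone (prox_point L h x))"
    and "r < \<infinity> \<Longrightarrow> is_arg_min f (\<lambda>_. True) y \<Longrightarrow> y = closest_point svec_cone (prox_point L h x)"
proof -
  define \<rho> where "\<rho> = max_eigenvalue L"
  have \<rho>: "\<rho> > 0" unfolding \<rho>_def using L by (rule max_eigenvalue_pos)
  define d where "d = 1 / 2 * (x \<bullet> (\<rho> *\<^sub>R x - L *v x)) - \<rho> / 2 * (norm (prox_point L h x))\<^sup>2 + c"
  have f': "f y = ereal (\<rho> / 2 * (norm (y - prox_point L h x))\<^sup>2 + d)
      + indicator_fun svec_cone y + r" for y
  proof -
    define a where "a = 1 / 2 * (y \<bullet> (L *v y)) - y \<bullet> h + c"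
    define b where "b = 1 / 2 * ((y - x) \<bullet> prox_operator L (y - x))"
    have "a + b = \<rho> / 2 * (norm (y - prox_point L h x))\<^sup>2 + d"
      using linearized_quadratic[of L y h x] L(1) \<rho>
      by (simp add: a_def b_def d_def prox_operator_def \<rho>_def psd_def)
    moreover have "f y = ereal (a + b) + indicator_fun svec_cone y + r"
      unfolding f a_def[symmetric] b_def[symmetric] plus_ereal.simps(1)[symmetric]
      by (simp only: ac_simps)
    ultimately show ?thesis by simp
  qed
  have "r \<noteq> - \<infinity>" using r by auto
  note step = closest_point_is_arg_min[OF closed_svec_cone convex_svec_cone svec_cone_nonempty
      \<rho> f' this]
  show "is_arg_min f (\<lambda>_. True) (closest_point svec_cone (prox_point L h x))"
    by (rule step(1))
  show "y = closest_point svec_cone (prox_point L h x)" if "r < \<infinity>" "is_arg_min f (\<lambda>_. True) y"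
    using that by (rule step(2))
qed

section \<open>The blocks of the objective\<close>

lemma indicator_fun_nonneg [simp]: "0 \<le> indicator_fun E x"
  by (simp add: indicator_fun_def)

lemma Lstar_update:
  assumes "i \<in> {1..M}"
  shows "Lstar M F R D1 T2 X0 (X(i := Y))
    = Lstar_without M F R D1 T2 i X0 X + transpose (T2 ** Xi (F i) ** D1) *v Y"
proof -
  have "(\<Sum>j=1..M. transpose (Xi (F j)) *v (transpose T2 *v (X(i := Y)) j))
    = transpose (Xi (F i)) *v (transpose T2 *v Y)
      + (\<Sum>j\<in>{1..M} - {i}. transpose (Xi (F j)) *v (transpose T2 *v X j))"
    using assms by (subst sum.remove[of _ i]) auto
  moreover have "(\<Sum>j=1..M. transpose (Xi (F j)) *v (transpose T2 *v X j))
    = transpose (Xi (F i)) *v (transpose T2 *v X i)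
      + (\<Sum>j\<in>{1..M} - {i}. transpose (Xi (F j)) *v (transpose T2 *v X j))"
    using assms by (intro sum.remove) auto
  ultimately show ?thesis
    by (simp add: Lstar_def Lstar_without_def matrix_vector_right_distrib matrix_transpose_mul
        matrix_vector_mul_assoc matrix_mul_assoc del: transpose_matrix_vector)
qed

lemma Lmat_properties:
  fixes F :: "nat \<Rightarrow> real^('n::finite + 'm::finite)^('n + 'm)"
    and D1 :: "real^(('n + 'm) uprod)^(('n + 'm) \<times> ('n + 'm))"
    and T2 :: "real^('n \<times> 'n)^('n uprod)" and i :: nat
  assumes G: "pd (matrix_inv (transpose D1 ** D1))" and "\<beta> > 0"
  defines "N \<equiv> T2 ** Xi (F i) ** D1"
  shows "Lmat F D1 T2 \<beta> i *v y
      = (1 / \<beta>) *\<^sub>R (N *v (matrix_inv (transpose D1 ** D1) *v (transpose N *v y)))"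
    and "psd (Lmat F D1 T2 \<beta> i)"
    and "N \<noteq> 0 \<Longrightarrow> Lmat F D1 T2 \<beta> i \<noteq> 0"
proof -
  define G where "G = matrix_inv (transpose D1 ** D1)"
  have sym: "transpose G = G" and pos: "\<And>x. x \<noteq> 0 \<Longrightarrow> 0 < x \<bullet> (G *v x)"
    using G by (auto simp: pd_def G_def)
  have L: "Lmat F D1 T2 \<beta> i = (1 / \<beta>) *\<^sub>R (N ** G ** transpose N)"
    by (simp add: Lmat_def N_def G_def matrix_transpose_mul matrix_mul_assoc)
  then have Lv: "Lmat F D1 T2 \<beta> i *v y = (1 / \<beta>) *\<^sub>R (N *v (G *v (transpose N *v y)))" for y
    by (simp add: scaleR_matrix_vector_assoc[symmetric] matrix_vector_mul_assoc[symmetric]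
        del: transpose_matrix_vector)
  then show "Lmat F D1 T2 \<beta> i *v y
      = (1 / \<beta>) *\<^sub>R (N *v (matrix_inv (transpose D1 ** D1) *v (transpose N *v y)))"
    by (simp add: G_def)
  have quad: "y \<bullet> (Lmat F D1 T2 \<beta> i *v y)
      = 1 / \<beta> * ((transpose N *v y) \<bullet> (G *v (transpose N *v y)))" for y
    using inner_matrix_vector_transpose[of N "G *v (transpose N *v y)" y]
    by (simp add: Lv inner_commute del: transpose_matrix_vector)
  have nonneg: "0 \<le> x \<bullet> (G *v x)" for x
    using pos[of x] by (cases "x = 0") auto
  have "transpose (Lmat F D1 T2 \<beta> i) = Lmat F D1 T2 \<beta> i"
    by (simp add: L transpose_scalar matrix_transpose_mul sym matrix_mul_assoc)
  then show "psd (Lmat F D1 T2 \<beta> i)"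
    using nonneg \<open>\<beta> > 0\<close> by (simp add: psd_def quad del: transpose_matrix_vector)
  show "Lmat F D1 T2 \<beta> i \<noteq> 0" if "N \<noteq> 0"
  proof
    assume "Lmat F D1 T2 \<beta> i = 0"
    then have "(transpose N *v y) \<bullet> (G *v (transpose N *v y)) = 0" for y
      using quad[of y] \<open>\<beta> > 0\<close> by (simp del: transpose_matrix_vector)
    then have "transpose N *v y = 0" for y
      using pos[of "transpose N *v y"] by (metis less_irrefl)
    then have "transpose N = 0" by (simp add: matrix_eq del: transpose_matrix_vector)
    then have "N = transpose 0" by (metis transpose_transpose)
    then have "N = 0" by (simp add: transpose_def vec_eq_iff)
    with that show False ..
  qed
qed

lemma Lmat0_properties:
  assumes G: "pd (matrix_inv (transpose D1 ** D1))" and "\<beta> > 0"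
  shows "psd (Lmat0 D1 \<beta>)" and "Lmat0 D1 \<beta> \<noteq> 0"
proof -
  define G where "G = matrix_inv (transpose D1 ** D1)"
  have sym: "transpose G = G" and pos: "\<And>x. x \<noteq> 0 \<Longrightarrow> 0 < x \<bullet> (G *v x)"
    using G by (auto simp: pd_def G_def)
  have quad: "x \<bullet> (Lmat0 D1 \<beta> *v x) = 1 / \<beta> * (x \<bullet> (G *v x))" for x
    by (simp add: Lmat0_def G_def scaleR_matrix_vector_assoc[symmetric])
  have nonneg: "0 \<le> x \<bullet> (G *v x)" for x
    using pos[of x] by (cases "x = 0") auto
  have "transpose (Lmat0 D1 \<beta>) = Lmat0 D1 \<beta>"
    using sym by (simp add: Lmat0_def G_def transpose_scalar)
  then show "psd (Lmat0 D1 \<beta>)" using nonneg \<open>\<beta> > 0\<close> by (simp add: psd_def quad)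
  show "Lmat0 D1 \<beta> \<noteq> 0"
  proof
    assume "Lmat0 D1 \<beta> = 0"
    then have "1 \<bullet> (G *v 1) = 0" using quad[of 1] \<open>\<beta> > 0\<close> by simp
    with pos[of 1] show False by simp
  qed
qed

text \<open>The constant \<open>c\<close> may depend on the other blocks; what matters is that it does not depend
  on \<open>Y\<close>.\<close>

lemma Omega_block:
  fixes F :: "nat \<Rightarrow> real^('n::finite + 'm::finite)^('n + 'm)"
  assumes D1: "duplication_matrix D1" and "\<beta> > 0" and i: "i \<in> {1..M}"
  obtains c where "\<And>Y. Omega M F Q R D1 T2 \<beta> \<xi> X0 (X(i := Y))
    = ereal (1 / 2 * (Y \<bullet> (Lmat F D1 T2 \<beta> i *v Y)) - Y \<bullet> Hvec M F Q R D1 T2 \<beta> \<xi> i X0 X + c)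
      + indicator_fun svec_cone Y
      + (indicator_fun svec_cone X0 + (\<Sum>j\<in>{1..M} - {i}. indicator_fun svec_cone (X j)))"
proof -
  define G where "G = matrix_inv (transpose D1 ** D1)"
  define N where "N = T2 ** Xi (F i) ** D1"
  define q where "q = T2 *v (kron V2 V2 *v vec_cols Q)"
  define g where "g = G *v (transpose D1 *v \<xi>)"
  define l where "l = Lstar_without M F R D1 T2 i X0 X"
  define e where "e = (\<Sum>j\<in>{1..M} - {i}. X j) \<bullet> q"
  define c where "c = 1 / (2 * \<beta>) * (l \<bullet> (G *v l)) - l \<bullet> g - e"
  have pdG: "pd G" unfolding G_def by (rule duplication_gram_inverse[OF D1])
  have H: "Hvec M F Q R D1 T2 \<beta> \<xi> i X0 X = q + N *v g - (1 / \<beta>) *\<^sub>R (N *v (G *v l))"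
    by (simp add: Hvec_def q_def N_def g_def G_def l_def matrix_vector_mul_assoc matrix_mul_assoc
        del: transpose_matrix_vector)
  have sym: "transpose G = G" using pdG by (simp add: pd_def)
  have adj: "y \<bullet> (N *v z) = (transpose N *v y) \<bullet> z" for y z
    using inner_matrix_vector_transpose[of N z y] by (metis inner_commute)
  have L: "Lmat F D1 T2 \<beta> i *v Y = (1 / \<beta>) *\<^sub>R (N *v (G *v (transpose N *v Y)))" for Y
    unfolding G_def N_def using pdG \<open>\<beta> > 0\<close> by (intro Lmat_properties) (simp add: G_def)
  have "Omega M F Q R D1 T2 \<beta> \<xi> X0 (X(i := Y))
    = ereal (1 / 2 * (Y \<bullet> (Lmat F D1 T2 \<beta> i *v Y)) - Y \<bullet> Hvec M F Q R D1 T2 \<beta> \<xi> i X0 X + c)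
      + indicator_fun svec_cone Y
      + (indicator_fun svec_cone X0 + (\<Sum>j\<in>{1..M} - {i}. indicator_fun svec_cone (X j)))" for Y
  proof -
    have ind: "(\<Sum>j=1..M. indicator_fun svec_cone ((X(i := Y)) j)) = indicator_fun svec_cone Y
        + (\<Sum>j\<in>{1..M} - {i}. indicator_fun svec_cone (X j))"
      using i by (subst sum.remove[of _ i]) auto
    have lin: "(\<Sum>j=1..M. (X(i := Y)) j) \<bullet> q = Y \<bullet> q + e"
      using i by (subst sum.remove[of _ i]) (auto simp: inner_add_left e_def)
    have "- (Y \<bullet> q) - (l + transpose N *v Y) \<bullet> g
          + 1 / (2 * \<beta>) * ((l + transpose N *v Y) \<bullet> (G *v (l + transpose N *v Y)))
        = 1 / 2 * (Y \<bullet> (Lmat F D1 T2 \<beta> i *v Y)) - Y \<bullet> Hvec M F Q R D1 T2 \<beta> \<xi> i X0 X + (c + e)"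
      unfolding H L c_def
      using quadratic_of_affine[of G "\<lambda>z. N *v z" "\<lambda>y. transpose N *v y" Y q l g \<beta>,
          OF sym adj]
      by linarith
    then have obj: "- ((\<Sum>j=1..M. (X(i := Y)) j) \<bullet> q) - (l + transpose N *v Y) \<bullet> g
          + 1 / (2 * \<beta>) * ((l + transpose N *v Y) \<bullet> (G *v (l + transpose N *v Y)))
        = 1 / 2 * (Y \<bullet> (Lmat F D1 T2 \<beta> i *v Y)) - Y \<bullet> Hvec M F Q R D1 T2 \<beta> \<xi> i X0 X + c"
      unfolding lin by linarith
    show ?thesis
      unfolding Omega_def Lstar_update[OF i] power2_norm_eq_inner ind
        duplication_gram_inverse(2)[OF D1]
      unfolding G_def[symmetric] N_def[symmetric] q_def[symmetric] l_def[symmetric]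
      unfolding g_def[symmetric] obj
      by (simp only: ac_simps)
  qed
  then show ?thesis by (rule that)
qed

text \<open>The vector \<open>Hvec0\<close> does not depend on the old value \<open>X0\<close> of block 0, which cancels
  in \<open>Lstar_without0\<close>.\<close>

lemma Omega_block0:
  fixes F :: "nat \<Rightarrow> real^('n::finite + 'm::finite)^('n + 'm)"
  assumes D1: "duplication_matrix D1" and "\<beta> > 0"
  obtains c where "\<And>Y. Omega M F Q R D1 T2 \<beta> \<xi> Y X
    = ereal (1 / 2 * (Y \<bullet> (Lmat0 D1 \<beta> *v Y)) - Y \<bullet> Hvec0 M F R D1 T2 \<beta> \<xi> X0 X + c)
      + indicator_fun svec_cone Y + (\<Sum>j=1..M. indicator_fun svec_cone (X j))"
proof -
  define G where "G = matrix_inv (transpose D1 ** D1)"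
  define g where "g = G *v (transpose D1 *v \<xi>)"
  define l where "l = Lstar_without0 M F R D1 T2 X0 X"
  define e where "e = (\<Sum>j=1..M. X j) \<bullet> (T2 *v (kron V2 V2 *v vec_cols Q))"
  define c where "c = 1 / (2 * \<beta>) * (l \<bullet> (G *v l)) - l \<bullet> g - e"
  have pdG: "pd G" unfolding G_def by (rule duplication_gram_inverse[OF D1])
  have neg: "G *v (- x) = - (G *v x)" for x
    using matrix_vector_mult_scaleR[of G "-1" x] by simp
  have H: "Hvec0 M F R D1 T2 \<beta> \<xi> X0 X = - g + (1 / \<beta>) *\<^sub>R (G *v l)"
    by (simp add: Hvec0_def g_def G_def l_def)
  have L: "Lmat0 D1 \<beta> *v Y = (1 / \<beta>) *\<^sub>R (G *v Y)" for Y
    by (simp add: Lmat0_def G_def scaleR_matrix_vector_assoc[symmetric])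
  have sym: "transpose G = G" using pdG by (simp add: pd_def)
  have "Omega M F Q R D1 T2 \<beta> \<xi> Y X
    = ereal (1 / 2 * (Y \<bullet> (Lmat0 D1 \<beta> *v Y)) - Y \<bullet> Hvec0 M F R D1 T2 \<beta> \<xi> X0 X + c)
      + indicator_fun svec_cone Y + (\<Sum>j=1..M. indicator_fun svec_cone (X j))" for Y
  proof -
    have upd: "Lstar M F R D1 T2 Y X = l + - Y"
      by (simp add: l_def Lstar_without0_def Lstar_def)
    have obj: "- e - (l + - Y) \<bullet> g + 1 / (2 * \<beta>) * ((l + - Y) \<bullet> (G *v (l + - Y)))
        = 1 / 2 * (Y \<bullet> (Lmat0 D1 \<beta> *v Y)) - Y \<bullet> Hvec0 M F R D1 T2 \<beta> \<xi> X0 X + c"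
      unfolding H L c_def
      using quadratic_of_affine[of G uminus uminus Y 0 l g \<beta>, OF sym]
      by (simp add: neg inner_add_right)
    show ?thesis
      unfolding Omega_def upd power2_norm_eq_inner duplication_gram_inverse(2)[OF D1]
      unfolding G_def[symmetric] e_def[symmetric]
      unfolding g_def[symmetric] obj ..
  qed
  then show ?thesis by (rule that)
qed

lemma Omega_finite_iff:
  "Omega M F Q R D1 T2 \<beta> \<xi> X0 X < \<infinity>
    \<longleftrightarrow> X0 \<in> svec_cone \<and> (\<forall>i\<in>{1..M}. X i \<in> svec_cone)"
proof -
  have "(\<Sum>i=1..M. indicator_fun svec_cone (X i)) < \<infinity> \<longleftrightarrow> (\<forall>i\<in>{1..M}. X i \<in> svec_cone)"
    by (auto simp: sum_Pinfty less_top[symmetric] top_ereal_def indicator_fun_def split: if_splits)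
  then show ?thesis
    by (auto simp: Omega_def indicator_fun_def)
qed


lemma V2_compression: "V2 ** block_mat P B C D ** transpose V2 = P"
proof -
  have "(V2 ** block_mat P B C D ** transpose V2) $ i $ j = P $ i $ j" for i j
    by (simp add: matrix_matrix_mult_def transpose_def V2_def block_mat_def
        if_distrib[of "\<lambda>x. x * _"] if_distrib[of "\<lambda>x. _ * x"] cong: if_cong)
  then show ?thesis by (simp add: vec_eq_iff)
qed

text \<open>Strict feasibility makes the block matrices nonzero: at a feasible \<open>W\<close> the first-order part
  of \<open>Upsilon\<close> has to outweigh the positive definite constant part.\<close>

lemma strictly_feasible_imp_nonzero:
  fixes F Q W :: "real^('n::finite + 'm::finite)^('n + 'm)"
    and T2 :: "real^('n \<times> 'n)^('n uprod)"
  assumes D1: "duplication_matrix D1"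
    and T2: "\<forall>S. transpose S = S \<longrightarrow> svec S = T2 *v vec_cols S"
    and W: "pd W" "pd (Upsilon F Q W)" and Q: "pd (V2 ** Q ** transpose V2 :: real^'n^'n)"
  shows "T2 ** Xi F ** D1 \<noteq> 0"
proof
  assume zero: "T2 ** Xi F ** D1 = 0"
  define Z :: "real^'n^'n" where "Z = V2 ** (F ** W + W ** transpose F) ** transpose V2"
  have symW: "transpose W = W" using W by (simp add: pd_def)
  have add: "transpose (A + B) = transpose A + transpose B" for A B :: "real^('n + 'm)^('n + 'm)"
    by (simp add: transpose_def vec_eq_iff)
  have symZ: "transpose Z = Z"
    by (simp add: Z_def matrix_transpose_mul add symW matrix_mul_assoc add.commute)
  have "svec Z = T2 *v (Xi F *v (D1 *v svec W))"
    using T2 symZ D1 symW by (simp add: Z_def duplication_matrix_def flip: Xi_vec_cols)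
  also have "\<dots> = 0" by (simp only: matrix_vector_mul_assoc matrix_mul_assoc zero matrix_vector_mult_0)
  finally have "smat (svec Z) = 0" by (simp add: vec_eq_iff)
  then have "Z = 0" by (simp only: smat_svec[OF symZ])
  moreover have "Upsilon F Q W = - (Z + V2 ** Q ** transpose V2)"
    by (simp add: Upsilon_def Z_def matrix_add_ldistrib matrix_add_rdistrib)
  ultimately have neg: "Upsilon F Q W = 0 - V2 ** Q ** transpose V2" by simp
  have "1 \<bullet> (Upsilon F Q W *v 1) = - (1 \<bullet> ((V2 ** Q ** transpose V2 :: real^'n^'n) *v 1))"
    unfolding neg matrix_vector_mult_diff_rdistrib inner_diff_right by simp
  moreover have "0 < 1 \<bullet> (Upsilon F Q W *v 1)"
    using W by (simp add: pd_def)
  moreover have "0 < 1 \<bullet> ((V2 ** Q ** transpose V2 :: real^'n^'n) *v 1)"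
    using Q by (simp add: pd_def)
  ultimately show False by linarith
qed

section \<open>Closed form of the iteration\<close>

lemma subproblem_closed_form:
  fixes F :: "nat \<Rightarrow> real^('n::finite + 'm::finite)^('n + 'm)"
    and T2 :: "real^('n \<times> 'n)^('n uprod)"
    and Q R :: "real^('n + 'm)^('n + 'm)" and \<xi> :: "real^(('n + 'm) \<times> ('n + 'm))"
    and X0 :: "nat \<Rightarrow> real^(('n + 'm) uprod)" and X :: "nat \<Rightarrow> nat \<Rightarrow> real^('n uprod)" and k :: nat
  assumes D1: "duplication_matrix D1" and "\<beta> > 0" and i: "i \<in> {1..M}"
    and N: "T2 ** Xi (F i) ** D1 \<noteq> 0"
    and S: "S i = prox_operator (Lmat F D1 T2 \<beta> i)"
  defines "f \<equiv> subproblem (Omega M F Q R D1 T2 \<beta> \<xi>) S X0 X k i"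
    and "p \<equiv> closest_point svec_cone (Delta M F Q R D1 T2 \<beta> \<xi> X0 X k i)"
  shows "is_arg_min f (\<lambda>_. True) p"
    and "X0 k \<in> svec_cone \<Longrightarrow> (\<And>j. j \<in> {1..M} - {i} \<Longrightarrow> mixed i (X k) (X (Suc k)) j \<in> svec_cone)
      \<Longrightarrow> is_arg_min f (\<lambda>_. True) y \<Longrightarrow> y = p"
proof -
  define Z where "Z = mixed i (X k) (X (Suc k))"
  define r where "r = indicator_fun svec_cone (X0 k)
    + (\<Sum>j\<in>{1..M} - {i}. indicator_fun svec_cone (Z j))"
  have pdG: "pd (matrix_inv (transpose D1 ** D1))" by (rule duplication_gram_inverse[OF D1])
  have L: "psd (Lmat F D1 T2 \<beta> i)" "Lmat F D1 T2 \<beta> i \<noteq> 0"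
    by (rule Lmat_properties[OF pdG \<open>\<beta> > 0\<close>])+ (rule N)
  obtain c where "\<And>Y. Omega M F Q R D1 T2 \<beta> \<xi> (X0 k) (Z(i := Y))
    = ereal (1 / 2 * (Y \<bullet> (Lmat F D1 T2 \<beta> i *v Y))
        - Y \<bullet> Hvec M F Q R D1 T2 \<beta> \<xi> i (X0 k) Z + c)
      + indicator_fun svec_cone Y + r"
    unfolding r_def using Omega_block[OF D1 \<open>\<beta> > 0\<close> i] by blast
  then have f: "f Y = ereal (1 / 2 * (Y \<bullet> (Lmat F D1 T2 \<beta> i *v Y))
        - Y \<bullet> Hvec M F Q R D1 T2 \<beta> \<xi> i (X0 k) Z + c) + indicator_fun svec_cone Y + r
      + ereal (1 / 2 * ((Y - X k i) \<bullet> prox_operator (Lmat F D1 T2 \<beta> i) (Y - X k i)))" for Y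
    by (simp only: f_def subproblem_def S Z_def)
  have "r \<ge> 0" unfolding r_def by (intro add_nonneg_nonneg sum_nonneg) simp_all
  note step = prox_block_step[OF L this f]
  show "is_arg_min f (\<lambda>_. True) p"
    using step(1) by (simp only: p_def Delta_def Z_def)
  assume "X0 k \<in> svec_cone"
    and "\<And>j. j \<in> {1..M} - {i} \<Longrightarrow> mixed i (X k) (X (Suc k)) j \<in> svec_cone"
  then have "r = 0"
    unfolding r_def Z_def by (simp add: indicator_fun_def)
  then have "r < \<infinity>" by simp
  then show "is_arg_min f (\<lambda>_. True) y \<Longrightarrow> y = p"
    using step(2) by (simp only: p_def Delta_def Z_def)
qed

lemma subproblem0_closed_form:
  fixes F :: "nat \<Rightarrow> real^('n::finite + 'm::finite)^('n + 'm)"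
    and T2 :: "real^('n \<times> 'n)^('n uprod)"
    and Q R :: "real^('n + 'm)^('n + 'm)" and \<xi> :: "real^(('n + 'm) \<times> ('n + 'm))"
    and X0 :: "nat \<Rightarrow> real^(('n + 'm) uprod)" and X :: "nat \<Rightarrow> nat \<Rightarrow> real^('n uprod)" and k M :: nat
  assumes D1: "duplication_matrix D1" and "\<beta> > 0"
  defines "f \<equiv> subproblem0 (Omega M F Q R D1 T2 \<beta> \<xi>) (prox_operator (Lmat0 D1 \<beta>)) X0 X k"
    and "p \<equiv> closest_point svec_cone (Delta0 M F R D1 T2 \<beta> \<xi> X0 X k)"
  shows "is_arg_min f (\<lambda>_. True) p"
    and "(\<And>j. j \<in> {1..M} \<Longrightarrow> X (Suc k) j \<in> svec_cone)
      \<Longrightarrow> is_arg_min f (\<lambda>_. True) y \<Longrightarrow> y = p"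
proof -
  define r where "r = (\<Sum>j=1..M. indicator_fun svec_cone (X (Suc k) j))"
  have pdG: "pd (matrix_inv (transpose D1 ** D1))" by (rule duplication_gram_inverse[OF D1])
  note L = Lmat0_properties[OF pdG \<open>\<beta> > 0\<close>]
  obtain c where "\<And>Y. Omega M F Q R D1 T2 \<beta> \<xi> Y (X (Suc k))
    = ereal (1 / 2 * (Y \<bullet> (Lmat0 D1 \<beta> *v Y))
        - Y \<bullet> Hvec0 M F R D1 T2 \<beta> \<xi> (X0 k) (X (Suc k)) + c)
      + indicator_fun svec_cone Y + r"
    unfolding r_def using Omega_block0[OF D1 \<open>\<beta> > 0\<close>] by blast
  then have f: "f Y = ereal (1 / 2 * (Y \<bullet> (Lmat0 D1 \<beta> *v Y))
        - Y \<bullet> Hvec0 M F R D1 T2 \<beta> \<xi> (X0 k) (X (Suc k)) + c) + indicator_fun svec_cone Y + r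
      + ereal (1 / 2 * ((Y - X0 k) \<bullet> prox_operator (Lmat0 D1 \<beta>) (Y - X0 k)))" for Y
    by (simp only: f_def subproblem0_def)
  have "r \<ge> 0" unfolding r_def by (intro sum_nonneg) simp
  note step = prox_block_step[OF L this f]
  show "is_arg_min f (\<lambda>_. True) p"
    using step(1) by (simp only: p_def Delta0_def)
  assume "\<And>j. j \<in> {1..M} \<Longrightarrow> X (Suc k) j \<in> svec_cone"
  then have "r = 0" unfolding r_def by (simp add: indicator_fun_def)
  then have "r < \<infinity>" by simp
  then show "is_arg_min f (\<lambda>_. True) y \<Longrightarrow> y = p"
    using step(2) by (simp only: p_def Delta0_def)
qed

text \<open>A run never leaves the cone, so all its subproblems have finite values and hence unique
  minimizers. Within one sweep this follows by downward induction on the block.\<close>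

lemma pbcd_run_closed_form:
  fixes F :: "nat \<Rightarrow> real^('n::finite + 'm::finite)^('n + 'm)"
    and T2 :: "real^('n \<times> 'n)^('n uprod)"
  assumes D1: "duplication_matrix D1" and "\<beta> > 0"
    and N: "\<And>i. i \<in> {1..M} \<Longrightarrow> T2 ** Xi (F i) ** D1 \<noteq> 0"
    and run: "pbcd_run M (Omega M F Q R D1 T2 \<beta> \<xi>) (prox_operator (Lmat0 D1 \<beta>))
      (\<lambda>i. prox_operator (Lmat F D1 T2 \<beta> i)) X0 X"
  shows "(\<forall>i\<in>{1..M}. X (Suc k) i = closest_point svec_cone (Delta M F Q R D1 T2 \<beta> \<xi> X0 X k i))
    \<and> X0 (Suc k) = closest_point svec_cone (Delta0 M F R D1 T2 \<beta> \<xi> X0 X k)"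
proof -
  have min: "is_arg_min (subproblem (Omega M F Q R D1 T2 \<beta> \<xi>)
      (\<lambda>i. prox_operator (Lmat F D1 T2 \<beta> i)) X0 X k i) (\<lambda>_. True) (X (Suc k) i)"
    if "i \<in> {1..M}" for k i
    using run that unfolding pbcd_run_def by blast
  have min0: "is_arg_min (subproblem0 (Omega M F Q R D1 T2 \<beta> \<xi>) (prox_operator (Lmat0 D1 \<beta>))
      X0 X k) (\<lambda>_. True) (X0 (Suc k))" for k
    using run unfolding pbcd_run_def by blast
  define dom where "dom k \<longleftrightarrow> X0 k \<in> svec_cone \<and> (\<forall>i\<in>{1..M}. X k i \<in> svec_cone)" for k
  have block: "X (Suc k) i = closest_point svec_cone (Delta M F Q R D1 T2 \<beta> \<xi> X0 X k i)"
    if "dom k" and "i \<in> {1..M}" for k i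
    using \<open>i \<in> {1..M}\<close>
  proof (induction "M - i" arbitrary: i rule: less_induct)
    case less
    have "mixed i (X k) (X (Suc k)) j \<in> svec_cone" if j: "j \<in> {1..M} - {i}" for j
    proof (cases "j \<le> i")
      case True
      then show ?thesis using \<open>dom k\<close> j by (simp add: mixed_def dom_def)
    next
      case False
      then have "X (Suc k) j = closest_point svec_cone (Delta M F Q R D1 T2 \<beta> \<xi> X0 X k j)"
        using j less.prems by (intro less.hyps) auto
      then show ?thesis using False closest_point_in_svec_cone by (simp add: mixed_def)
    qed
    then show ?case
      using \<open>dom k\<close> less.prems
      by (intro subproblem_closed_form(2)[OF D1 \<open>\<beta> > 0\<close> _ N _ _ _ min]) (auto simp: dom_def)
  qed
  have block0: "X0 (Suc k) = closest_point svec_cone (Delta0 M F R D1 T2 \<beta> \<xi> X0 X k)"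
    if "dom k" for k
    using block[OF that] closest_point_in_svec_cone
    by (intro subproblem0_closed_form(2)[OF D1 \<open>\<beta> > 0\<close> _ min0]) simp
  have "dom k" for k
  proof (induction k)
    case 0
    show ?case using run unfolding pbcd_run_def Omega_finite_iff dom_def by blast
  next
    case (Suc k)
    then show ?case
      using block block0 by (simp add: dom_def[of "Suc k"] closest_point_in_svec_cone)
  qed
  then show ?thesis using block block0 by blast
qed

theorem lemma2:
  fixes A :: "real^'n^'n" and B2 :: "real^'m^'n" and B1 :: "real^'l^'n"
    and C :: "real^'n^'q" and D :: "real^'m^'q"
    and M :: nat
    and As :: "nat \<Rightarrow> real^'n^'n" and B2s :: "nat \<Rightarrow> real^'m^'n"
    and F :: "nat \<Rightarrow> real^('n + 'm)^('n + 'm)"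
    and Q R :: "real^('n + 'm)^('n + 'm)"
    and D1 :: "real^(('n + 'm) uprod)^(('n + 'm) \<times> ('n + 'm))"
    and T2 :: "real^('n \<times> 'n)^('n uprod)"
    and \<beta> :: real and \<xi> :: "real^(('n + 'm) \<times> ('n + 'm))"
  assumes "M \<ge> 1"
    and Q_eq: "Q = block_mat (B1 ** transpose B1) 0 0 0"
    and R_eq: "R = block_mat (transpose C ** C) 0 0 (transpose D ** D)"
    and F_eq: "\<forall>i\<in>{1..M}. F i = block_mat (As i) (B2s i) 0 0"
    and "transpose C ** D = 0" and "pd (transpose D ** D)" and "pd (transpose C ** C)"
    and "pd (B1 ** transpose B1)"
    and "stabilizable A B2"
    and "\<forall>a. unobservable_mode A C a \<longrightarrow> Re a \<noteq> 0"
    and "block_mat A B2 0 0 \<in> convex hull (F ` {1..M})"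
    and "\<exists>W. pd W \<and> (\<forall>i\<in>{1..M}. pd (Upsilon (F i) Q W))"
    and "\<forall>W. psd W \<and> (\<forall>i\<in>{1..M}. psd (Upsilon (F i) Q W)) \<longrightarrow> pd (upper_left W)"
    and D1: "\<forall>W. transpose W = W \<longrightarrow> vec_cols W = D1 *v svec W"
    and T2: "\<forall>S. transpose S = S \<longrightarrow> svec S = T2 *v vec_cols S"
    and "\<beta> > 0"
  shows "\<exists>S0 S. psd_operator S0 \<and> (\<forall>i\<in>{1..M}. psd_operator (S i)) \<and>
    (\<forall>X0 X.
      (\<forall>k.
        (\<forall>i\<in>{1..M}. is_arg_min (subproblem (Omega M F Q R D1 T2 \<beta> \<xi>) S X0 X k i) (\<lambda>_. True)
           (closest_point svec_cone (Delta M F Q R D1 T2 \<beta> \<xi> X0 X k i))) \<and>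
        is_arg_min (subproblem0 (Omega M F Q R D1 T2 \<beta> \<xi>) S0 X0 X k) (\<lambda>_. True)
          (closest_point svec_cone (Delta0 M F R D1 T2 \<beta> \<xi> X0 X k))) \<and>
      (pbcd_run M (Omega M F Q R D1 T2 \<beta> \<xi>) S0 S X0 X \<longrightarrow>
        (\<forall>k.
          (\<forall>i\<in>{1..M}.
            X (Suc k) i = closest_point svec_cone (Delta M F Q R D1 T2 \<beta> \<xi> X0 X k i)) \<and>
          X0 (Suc k) = closest_point svec_cone (Delta0 M F R D1 T2 \<beta> \<xi> X0 X k))))"
proof -
  have dup: "duplication_matrix D1" using D1 by (simp add: duplication_matrix_def)
  have pdG: "pd (matrix_inv (transpose D1 ** D1))" by (rule duplication_gram_inverse[OF dup])
  obtain W where W: "pd W" "\<forall>i\<in>{1..M}. pd (Upsilon (F i) Q W)"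
    using \<open>\<exists>W. pd W \<and> (\<forall>i\<in>{1..M}. pd (Upsilon (F i) Q W))\<close> by blast
  have "pd (V2 ** Q ** transpose V2 :: real^'n^'n)"
    unfolding Q_eq V2_compression by fact
  then have N: "T2 ** Xi (F i) ** D1 \<noteq> 0" if "i \<in> {1..M}" for i
    using strictly_feasible_imp_nonzero[OF dup T2 W(1)] W(2) that by blast
  define S0 where "S0 = prox_operator (Lmat0 D1 \<beta>)"
  define S where "S = (\<lambda>i. prox_operator (Lmat F D1 T2 \<beta> i))"
  have "psd_operator S0"
    unfolding S0_def using Lmat0_properties(1)[OF pdG \<open>\<beta> > 0\<close>]
    by (intro psd_prox_operator) (simp add: psd_def)
  moreover have "psd_operator (S i)" for i
    unfolding S_def using Lmat_properties(2)[OF pdG \<open>\<beta> > 0\<close>, of F T2 i]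
    by (intro psd_prox_operator) (simp add: psd_def)
  moreover have "is_arg_min (subproblem (Omega M F Q R D1 T2 \<beta> \<xi>) S X0 X k i) (\<lambda>_. True)
      (closest_point svec_cone (Delta M F Q R D1 T2 \<beta> \<xi> X0 X k i))" if "i \<in> {1..M}" for X0 X k i
    by (rule subproblem_closed_form(1)[OF dup \<open>\<beta> > 0\<close> that]) (rule N[OF that], simp add: S_def)
  moreover have "is_arg_min (subproblem0 (Omega M F Q R D1 T2 \<beta> \<xi>) S0 X0 X k) (\<lambda>_. True)
      (closest_point svec_cone (Delta0 M F R D1 T2 \<beta> \<xi> X0 X k))" for X0 X k
    unfolding S0_def by (rule subproblem0_closed_form(1)[OF dup \<open>\<beta> > 0\<close>])
  moreover have "(\<forall>i\<in>{1..M}. X (Suc k) i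
        = closest_point svec_cone (Delta M F Q R D1 T2 \<beta> \<xi> X0 X k i))
      \<and> X0 (Suc k) = closest_point svec_cone (Delta0 M F R D1 T2 \<beta> \<xi> X0 X k)"
    if "pbcd_run M (Omega M F Q R D1 T2 \<beta> \<xi>) S0 S X0 X" for X0 X k
    using pbcd_run_closed_form[OF dup \<open>\<beta> > 0\<close> N that[unfolded S0_def S_def]] .
  ultimately show ?thesis by blast
qed

end
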